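(* Let $T$ be a tree of order $n$ (i.e. with $n$ vertices). Then $h(T)\leq \lceil \tfrac12\log_2(n)\rceil$.
   Context: The game: on a finite graph $G$, an invisible mouse and a team of $r$ cats ($r \ge 0$) play as follows. In round $i=1,2,\dots$ the mouse is at some vertex $v_i$, where $v_1$ is arbitrary and for $i\ge 2$ the vertex $v_i$ must be adjacent to $v_{i-1}$ (the mouse must move at every turn). Then each cat chooses any vertex of $G$ (cats are not constrained to move along edges); the mouse is caught in round $i$ if some cat chooses $v_i$. The cats never see the mouse, so a strategy for $r$ cats is a sequence $C_1,C_2,\dots$ of subsets of $V(G)$, each of size at most $r$, and the mouse evades it indefinitely if there is an infinite sequence of vertices $v_1,v_2,\dots$ with $v_i$ adjacent to $v_{i+1}$ and $v_i\notin C_i$ for all $i\ge 1$. The graph $G$ is an $r$-cat-win if some strategy for $r$ cats cannot be evaded indefinitely (equivalently, for finite $G$: there is a finite sequence $C_1,\dots,C_t$ of sets of size at most $r$ such that every walk $v_1,\dots,v_t$ in $G$ has $v_i\in C_i$ for some $i$); otherwise $G$ is an $r$-mouse-win. $h(G)$ denotes the least integer $r$ such that $G$ is an $r$-cat-win. *)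

theory Defs
  imports Complex_Main "Graph_Theory.Digraph_Component"
begin

text \<open>
  Following the Graph_Theory library, a finite simple graph is a symmetric digraph satisfying
  the locale \<^locale>\<open>graph\<close>. The library's \<^const>\<open>tree\<close> cannot be applied to such a
  digraph: the two arcs \<open>(u, v)\<close> and \<open>(v, u)\<close> representing an edge already form a
  \<^const>\<open>pre_digraph.cycle\<close>. The cycles of the undirected graph are exactly the cycles of
  length at least 3. The library's connectedness includes being nonempty.
\<close>

definition undirected_tree :: "('a, 'b) pre_digraph \<Rightarrow> bool" where
  "undirected_tree G \<longleftrightarrow>
     graph G \<and> Digraph_Component.connected G \<and>
     \<not> (\<exists>p. pre_digraph.cycle G p \<and> 3 \<le> length p)"

text \<open>Rounds are numbered from 0 rather than from 1.\<close>

definition cat_strategy :: "('a, 'b) pre_digraph \<Rightarrow> nat \<Rightarrow> (nat \<Rightarrow> 'a set) \<Rightarrow> bool" where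
  "cat_strategy G r C \<longleftrightarrow> (\<forall>i. C i \<subseteq> verts G \<and> finite (C i) \<and> card (C i) \<le> r)"

definition evades :: "('a, 'b) pre_digraph \<Rightarrow> (nat \<Rightarrow> 'a set) \<Rightarrow> (nat \<Rightarrow> 'a) \<Rightarrow> bool" where
  "evades G C v \<longleftrightarrow>
     (\<forall>i. v i \<in> verts G) \<and> (\<forall>i. v i \<rightarrow>\<^bsub>G\<^esub> v (Suc i)) \<and> (\<forall>i. v i \<notin> C i)"

definition cat_win :: "('a, 'b) pre_digraph \<Rightarrow> nat \<Rightarrow> bool" where
  "cat_win G r \<longleftrightarrow> (\<exists>C. cat_strategy G r C \<and> \<not> (\<exists>v. evades G C v))"

definition cat_number :: "('a, 'b) pre_digraph \<Rightarrow> nat" where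
  "cat_number G = (LEAST r. cat_win G r)"

text \<open>On a finite graph the minimum defining \<^const>\<open>cat_number\<close> is attained.\<close>

lemma cat_win_card_verts:
  assumes "finite (verts G)"
  shows "cat_win G (card (verts G))"
  unfolding cat_win_def cat_strategy_def evades_def
  using assms by (intro exI[of _ "\<lambda>_. verts G"]) auto

lemma cat_win_cat_number:
  assumes "finite (verts G)"
  shows "cat_win G (cat_number G)"
  unfolding cat_number_def using cat_win_card_verts[OF assms] by (rule LeastI)

end

theory Submission
  imports Defs
begin

text \<open>
  A tree is bipartite, so once the parity of the mouse is fixed, guarding a vertex \<open>g\<close> costs a cat
  only in every second round: half a cat. By induction on \<open>k\<close>, \<open>k\<close> cats clear every tree with at
  most \<open>4 ^ k\<close> vertices, and \<open>k\<close> cats in the rounds of one parity with \<open>k + 1\<close> in the others clear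
  every tree with at most \<open>4 ^ (k + 1) / 3\<close> vertices. With \<open>k + 1\<close> cats and \<open>4 ^ (k + 1)\<close> vertices, a
  guard walks along a path all of whose hanging components have at most a third of the vertices,
  and the remaining \<open>k + 1 / 2\<close> cats clear these. With \<open>k + 1 / 2\<close> cats, the half cat guards a
  vertex chosen by an extremal branch argument, whose removal leaves components that are small
  enough for the remaining cats.
\<close>

section \<open>Connected sets and components\<close>

text \<open>For symmetric \<open>adj\<close> the sets closed in \<open>Y\<close> are the unions of
  components of the graph induced on \<open>Y\<close>; connectedness is derived from them without
  paths.\<close>

definition closed_in :: "('a \<Rightarrow> 'a \<Rightarrow> bool) \<Rightarrow> 'a set \<Rightarrow> 'a set \<Rightarrow> bool" where
  "closed_in adj Y S \<longleftrightarrow> S \<subseteq> Y \<and> (\<forall>x\<in>S. \<forall>y\<in>Y. adj x y \<longrightarrow> y \<in> S)"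

definition conn :: "('a \<Rightarrow> 'a \<Rightarrow> bool) \<Rightarrow> 'a set \<Rightarrow> bool" where
  "conn adj X \<longleftrightarrow> X \<noteq> {} \<and> (\<forall>S. closed_in adj X S \<and> S \<noteq> {} \<longrightarrow> S = X)"

definition component :: "('a \<Rightarrow> 'a \<Rightarrow> bool) \<Rightarrow> 'a set \<Rightarrow> 'a set \<Rightarrow> bool" where
  "component adj Y D \<longleftrightarrow> closed_in adj Y D \<and> conn adj D"

lemma closed_inD: "closed_in adj Y S \<Longrightarrow> x \<in> S \<Longrightarrow> y \<in> Y \<Longrightarrow> adj x y \<Longrightarrow> y \<in> S"
  by (auto simp: closed_in_def)

lemma componentD:
  assumes "component adj Y D"
  shows "D \<subseteq> Y" "closed_in adj Y D" "conn adj D" "D \<noteq> {}"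
  using assms by (auto simp: component_def closed_in_def conn_def)

text \<open>Acyclicity enters as \<open>unique_neighbour\<close>: two neighbours of \<open>u\<close>
  in a connected set avoiding \<open>u\<close> would close a cycle.\<close>

locale forest =
  fixes adj :: "'a \<Rightarrow> 'a \<Rightarrow> bool"
  assumes adj_sym: "adj x y \<Longrightarrow> adj y x"
    and adj_irrefl: "\<not> adj x x"
    and unique_neighbour:
      "conn adj D \<Longrightarrow> u \<notin> D \<Longrightarrow> a \<in> D \<Longrightarrow> b \<in> D \<Longrightarrow> adj u a \<Longrightarrow> adj u b \<Longrightarrow> a = b"
begin

lemma closed_in_Diff: "closed_in adj Y S \<Longrightarrow> closed_in adj Y T \<Longrightarrow> closed_in adj Y (S - T)"
  unfolding closed_in_def using adj_sym by blast

text \<open>The least closed set containing \<open>d\<close> works: a proper nonempty closed part of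
  it, or else the complement of that part, would be a smaller closed set containing
  \<open>d\<close>.\<close>

lemma component_exists:
  assumes "d \<in> Y"
  shows "\<exists>D. component adj Y D \<and> d \<in> D"
proof -
  define D where "D = \<Inter>{S. closed_in adj Y S \<and> d \<in> S}"
  have d: "d \<in> D" by (auto simp: D_def)
  have Y: "closed_in adj Y Y" by (auto simp: closed_in_def)
  have "D \<subseteq> Y" using Y assms by (auto simp: D_def)
  moreover have "y \<in> D" if "x \<in> D" "y \<in> Y" "adj x y" for x y
    unfolding D_def
  proof (rule InterI)
    fix S assume S: "S \<in> {S. closed_in adj Y S \<and> d \<in> S}"
    then have "x \<in> S" using that(1) unfolding D_def by (rule InterD[rotated])
    moreover have "closed_in adj Y S" using S by simp
    ultimately show "y \<in> S" using that(2,3) by (meson closed_inD)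
  qed
  ultimately have cl: "closed_in adj Y D" by (simp add: closed_in_def)
  have "S = D" if S: "closed_in adj D S" "S \<noteq> {}" for S
  proof (rule ccontr)
    assume ne: "S \<noteq> D"
    have S': "closed_in adj Y S" using S(1) cl unfolding closed_in_def by blast
    show False
    proof (cases "d \<in> S")
      case True
      then have "D \<subseteq> S" using S' by (auto simp: D_def)
      then show False using ne S(1) by (auto simp: closed_in_def)
    next
      case False
      then have "D \<subseteq> D - S" using closed_in_Diff[OF cl S'] d unfolding D_def by blast
      then show False using S by (auto simp: closed_in_def)
    qed
  qed
  then have "component adj Y D" using cl d by (auto simp: component_def conn_def)
  then show ?thesis using d by blast
qed

lemma Union_components: "\<Union>{D. component adj Y D} = Y"
  using component_exists[of _ Y] componentD(1)[of adj Y] by blast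

lemma components_disjoint:
  assumes "component adj Y D" "component adj Y E" "D \<noteq> E"
  shows "D \<inter> E = {}"
proof (rule ccontr)
  assume ne: "D \<inter> E \<noteq> {}"
  have "closed_in adj D (D \<inter> E)" "closed_in adj E (D \<inter> E)"
    using assms(1,2) unfolding component_def closed_in_def by blast+
  then have "D \<inter> E = D" "D \<inter> E = E"
    using ne componentD(3)[OF assms(1)] componentD(3)[OF assms(2)] unfolding conn_def by simp_all
  then show False using assms(3) by blast
qed

lemma finite_components: "finite Y \<Longrightarrow> finite {D. component adj Y D}"
  by (rule finite_subset[of _ "Pow Y"]) (auto dest: componentD(1))

lemma component_neighbour:
  assumes "conn adj X" "u \<in> X" "component adj (X - {u}) D"
  shows "\<exists>d\<in>D. adj u d"
proof (rule ccontr)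
  assume "\<not> (\<exists>d\<in>D. adj u d)"
  then have "closed_in adj X D"
    using componentD(2)[OF assms(3)] adj_sym unfolding closed_in_def by blast
  then have "D = X" using assms componentD(4)[OF assms(3)] by (auto simp: conn_def)
  then show False using assms componentD(1)[OF assms(3)] by auto
qed

text \<open>\<open>u\<close>-\<open>d\<close> is the only edge between \<open>D\<close> and
  \<open>X - D\<close>, so crossing it replaces the branch \<open>D\<close> at \<open>u\<close> by
  its complement, a branch at \<open>d\<close>.\<close>

lemma component_complement:
  assumes X: "conn adj X" "u \<in> X" and D: "component adj (X - {u}) D" and d: "d \<in> D" "adj u d"
  shows "component adj (X - {d}) (X - D)"
proof -
  note DD = componentD[OF D]
  have u: "u \<notin> D" using DD(1) by auto
  have returns: "x \<in> D" if "y \<in> D" "adj x y" "x \<in> X" "x \<noteq> u" for x y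
    using closed_inD[OF DD(2)] that adj_sym by blast
  have 1: "closed_in adj (X - {d}) (X - D)"
    unfolding closed_in_def
  proof (intro conjI ballI impI)
    fix x y assume xy: "x \<in> X - D" "y \<in> X - {d}" "adj x y"
    have "x = u" if "y \<in> D" using returns[of y x] that xy by auto
    then show "y \<in> X - D"
      using unique_neighbour[OF DD(3) u _ d(1) _ d(2)] xy by blast
  qed (use d in auto)
  have "S = X - D" if S: "closed_in adj (X - D) S" "S \<noteq> {}" for S
  proof (cases "u \<in> S")
    case True
    have "closed_in adj X (S \<union> D)"
      using S(1) DD(1,2) True unfolding closed_in_def by blast
    then have "S \<union> D = X" using X d by (auto simp: conn_def)
    then show ?thesis using S by (auto simp: closed_in_def)
  next
    case False
    have "closed_in adj X S"
      using S(1) returns False unfolding closed_in_def by blast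
    then have "S = X" using X S by (auto simp: conn_def)
    then show ?thesis using False X by auto
  qed
  then show ?thesis using 1 X u by (auto simp: component_def conn_def)
qed

section \<open>Branches of controlled size\<close>

lemma exists_component_le_half:
  assumes X: "conn adj X" "finite X" and "2 \<le> card X" "card X \<le> 2 * s"
  shows "\<exists>u\<in>X. \<exists>K. component adj (X - {u}) K \<and> card K \<le> s"
proof -
  obtain u where u: "u \<in> X" using assms by (auto simp: conn_def)
  have "card (X - {u}) \<noteq> 0" using assms u by (simp add: card_Diff_singleton)
  then obtain z where "z \<in> X - {u}" by (metis card.empty equals0I)
  then obtain K where K: "component adj (X - {u}) K"
    using component_exists[of z "X - {u}"] by blast
  obtain d where d: "d \<in> K" "adj u d" using component_neighbour[OF X(1) u K] by blast
  have sub: "K \<subseteq> X" using componentD(1)[OF K] by blast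
  have "card (X - K) = card X - card K"
    using sub X(2) by (meson card_Diff_subset finite_subset)
  then have "card K \<le> s \<or> card (X - K) \<le> s" using assms by linarith
  then show ?thesis
    using K u component_complement[OF X(1) u K d] d sub by blast
qed

text \<open>\<open>K\<close> is a largest branch with at most \<open>s\<close> vertices, over all
  \<open>u\<close>. If another branch \<open>D\<close> at \<open>u\<close> left at most
  \<open>s\<close> vertices outside it, \<open>X - D\<close> would be such a branch at a neighbour
  of \<open>u\<close>, and larger, as it contains \<open>K\<close> and \<open>u\<close>.\<close>

lemma exists_maximal_component:
  assumes X: "conn adj X" "finite X" and "2 \<le> card X" "card X \<le> 2 * s"
  obtains u K where "u \<in> X" "component adj (X - {u}) K" "card K \<le> s"
    "\<And>D. component adj (X - {u}) D \<Longrightarrow> D \<noteq> K \<Longrightarrow> s + card D < card X"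
proof -
  define P where "P = (\<lambda>(u, K). u \<in> X \<and> component adj (X - {u}) K \<and> card K \<le> s)"
  have "\<exists>z. P z" using exists_component_le_half[OF assms] by (auto simp: P_def)
  moreover have "\<forall>z. P z \<longrightarrow> card (snd z) \<le> s" by (auto simp: P_def)
  ultimately obtain z where z: "P z" "\<And>z'. P z' \<Longrightarrow> card (snd z') \<le> card (snd z)"
    using Lattices_Big.ex_has_greatest_nat[of P _ "\<lambda>z. card (snd z)" "Suc s"]
    by (metis less_Suc_eq_le)
  obtain u K where zz: "z = (u, K)" by (cases z)
  have u: "u \<in> X" and K: "component adj (X - {u}) K" "card K \<le> s"
    using z(1) by (auto simp: P_def zz)
  have "s + card D < card X" if D: "component adj (X - {u}) D" "D \<noteq> K" for D
  proof (rule ccontr)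
    assume big: "\<not> s + card D < card X"
    obtain d where d: "d \<in> D" "adj u d" using component_neighbour[OF X(1) u D(1)] by blast
    note co = component_complement[OF X(1) u D(1) d]
    have sub: "D \<subseteq> X - {u}" "K \<subseteq> X - {u}" using componentD(1) D K by blast+
    have "card (X - D) = card X - card D"
      using sub(1) X(2) by (metis Diff_subset card_Diff_subset finite_subset subset_trans)
    then have "P (d, X - D)" using co big d sub by (auto simp: P_def)
    then have "card (X - D) \<le> card K" using z(2) by (fastforce simp: zz)
    moreover have "K \<subset> X - D"
      using components_disjoint[OF D(1) K(1) D(2)] sub u by blast
    then have "card K < card (X - D)" using X(2) by (intro psubset_card_mono) auto
    ultimately show False by simp
  qed
  then show thesis using that u K by blast
qed

lemma proper_colouring_exists:
  assumes "conn adj X" "finite X"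
  shows "\<exists>col :: 'a \<Rightarrow> bool. \<forall>x\<in>X. \<forall>y\<in>X. adj x y \<longrightarrow> col x \<noteq> col y"
  using assms
proof (induction "card X" arbitrary: X rule: less_induct)
  case less
  show ?case
  proof (cases "2 \<le> card X")
    case False
    then have "card X \<le> 1" by simp
    then have "x = y" if "x \<in> X" "y \<in> X" for x y
      using that less.prems(2) by (auto simp: card_le_Suc0_iff_eq)
    then show ?thesis using adj_irrefl by metis
  next
    case True
    \<comment> \<open>With the bound \<open>card X - 1\<close> every branch other than
      \<open>K\<close> has fewer than one vertex, so \<open>u\<close> is a leaf; it gets the colour
      opposite to that of its neighbour.\<close>
    obtain u K where u: "u \<in> X" and K: "component adj (X - {u}) K"
      and max: "\<And>D. component adj (X - {u}) D \<Longrightarrow> D \<noteq> K \<Longrightarrow> card X - 1 + card D < card X"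
      by (rule exists_maximal_component[of X "card X - 1"]) (use less.prems True in auto)
    have fin: "finite D" if "component adj (X - {u}) D" for D
      using componentD(1)[OF that] less.prems(2) finite_subset by blast
    have "D = K" if "component adj (X - {u}) D" for D
    proof (rule ccontr)
      assume "D \<noteq> K"
      then have "card D = 0" using max[OF that] by linarith
      then show False using fin[OF that] componentD(4)[OF that] by simp
    qed
    then have "{D. component adj (X - {u}) D} = {K}" using K by blast
    then have KX: "X - {u} = K" using Union_components[of "X - {u}"] by simp
    have "card K < card X" unfolding KX[symmetric] using u less.prems(2) by (rule card_Diff1_less[rotated])
    then obtain col where col: "\<forall>x\<in>K. \<forall>y\<in>K. adj x y \<longrightarrow> col x \<noteq> (col y :: bool)"
      using less.hyps componentD(3)[OF K] fin[OF K] by blast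
    obtain d where d: "d \<in> K" "adj u d" using component_neighbour[OF less.prems(1) u K] by blast
    have uK: "u \<notin> K" using KX by blast
    have "z = d" if "z \<in> K" "adj u z" for z
      using unique_neighbour[OF componentD(3)[OF K] uK] d that by blast
    then have "\<forall>x\<in>X. \<forall>y\<in>X. adj x y \<longrightarrow> (col(u := \<not> col d)) x \<noteq> (col(u := \<not> col d)) y"
      using col KX adj_irrefl adj_sym by (auto; metis DiffI singletonD)
    then show ?thesis by blast
  qed
qed

end

section \<open>The game for a mouse of known parity\<close>

locale bipartite_forest = forest adj for adj :: "'a \<Rightarrow> 'a \<Rightarrow> bool" +
  fixes col :: "'a \<Rightarrow> bool"
  assumes col_adj: "adj x y \<Longrightarrow> col x \<noteq> col y"
begin

text \<open>
  \<open>reach X b p S q S'\<close>: a mouse confined to \<open>X\<close> that is now at a vertex of colour \<open>p\<close> in \<open>S\<close> can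
  be forced to be, at some later time, at a vertex of colour \<open>q\<close> in \<open>S'\<close>, where \<open>b c\<close> cats are
  available whenever the mouse is at a vertex of colour \<open>c\<close>. Only the vertices of colour \<open>p\<close>
  in \<open>S\<close> matter.
\<close>

inductive reach :: "'a set \<Rightarrow> (bool \<Rightarrow> nat) \<Rightarrow> bool \<Rightarrow> 'a set \<Rightarrow> bool \<Rightarrow> 'a set \<Rightarrow> bool"
  for X b where
  stop: "(\<And>x. x \<in> S \<Longrightarrow> x \<in> X \<Longrightarrow> col x = p \<Longrightarrow> x \<in> S') \<Longrightarrow> reach X b p S p S'"
| step: "finite C \<Longrightarrow> C \<subseteq> X \<Longrightarrow> card C \<le> b (\<not> p) \<Longrightarrow>
    (\<And>x y. x \<in> S \<Longrightarrow> x \<in> X \<Longrightarrow> y \<in> X \<Longrightarrow> adj x y \<Longrightarrow> col y = (\<not> p) \<Longrightarrow> y \<notin> C \<Longrightarrow> y \<in> S1) \<Longrightarrow>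
    reach X b (\<not> p) S1 q S' \<Longrightarrow> reach X b p S q S'"

text \<open>Both starting colours are demanded because the attack on a piece may begin when the
  mouse has either colour.\<close>

definition clr :: "'a set \<Rightarrow> (bool \<Rightarrow> nat) \<Rightarrow> bool" where
  "clr X b \<longleftrightarrow> (\<forall>p. \<exists>q. reach X b p X q {})"

lemma reach_single_step:
  assumes "finite C" "C \<subseteq> X" "card C \<le> b (\<not> p)"
    "\<And>x y. x \<in> S \<Longrightarrow> x \<in> X \<Longrightarrow> y \<in> X \<Longrightarrow> adj x y \<Longrightarrow> col y = (\<not> p) \<Longrightarrow> y \<notin> C \<Longrightarrow> y \<in> S1"
  shows "reach X b p S (\<not> p) S1"
  using assms by (rule step[of C X b p S S1]) (auto intro: stop)

lemma reach_mono_left: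
  assumes "reach X b p S q T" "\<And>x. x \<in> S' \<Longrightarrow> x \<in> X \<Longrightarrow> col x = p \<Longrightarrow> x \<in> S"
  shows "reach X b p S' q T"
  using assms
proof (cases rule: reach.cases)
  case stop
  then show ?thesis using assms(2) by (auto intro: reach.stop)
next
  case (step C S1)
  show ?thesis
    by (rule reach.step[OF step(1-3) _ step(5)]) (use step(4) assms(2) col_adj in blast)
qed

lemma reach_trans:
  assumes "reach X b p S q T" "reach X b q T r U"
  shows "reach X b p S r U"
  using assms
proof (induction rule: reach.induct)
  case (stop S p S')
  then show ?case using reach_mono_left by blast
next
  case (step C p S S1 q S')
  show ?case by (rule reach.step[of C X b p S S1]) (use step in auto)
qed

lemma reach_mono_budget:
  assumes "reach X b p S q T" "\<And>c. b c \<le> b' c"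
  shows "reach X b' p S q T"
  using assms
proof (induction rule: reach.induct)
  case (stop S p S')
  then show ?case by (auto intro: reach.stop)
next
  case (step C p S S1 q S')
  show ?case
    by (rule reach.step[OF step(1,2) _ step(4)]) (use step in \<open>auto intro: order_trans\<close>)
qed

lemma clr_mono: "clr X b \<Longrightarrow> (\<And>c. b c \<le> b' c) \<Longrightarrow> clr X b'"
  unfolding clr_def using reach_mono_budget by meson

text \<open>The mouse must move in every round, so it cannot remain at a single vertex; even zero
  cats suffice.\<close>

lemma clr_card_le_1:
  assumes "finite X" "card X \<le> 1"
  shows "clr X b"
proof -
  have "x = y" if "x \<in> X" "y \<in> X" for x y
    using that assms by (auto simp: card_le_Suc0_iff_eq)
  then have "reach X b p X (\<not> p) {}" for p
    using adj_irrefl by (intro reach_single_step[of "{}"]) auto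
  then show ?thesis unfolding clr_def by blast
qed

text \<open>From \<open>S\<close> the mouse can leave only through \<open>g\<close>. If it does not
  have the colour of \<open>g\<close>, one round with a cat at \<open>g\<close> brings it to that
  colour without letting it out.\<close>

lemma reach_keep_guard:
  assumes "g \<in> X" "closed_in adj (X - {g}) S" "1 \<le> b (col g)"
  shows "reach X b p S (col g) S"
proof (cases "p = col g")
  case True
  then show ?thesis by (auto intro: stop)
next
  case False
  then have p: "col g = (\<not> p)" by auto
  show ?thesis unfolding p
    by (rule reach_single_step[of "{g}"]) (use assms p in \<open>auto dest: closed_inD\<close>)
qed

lemma reach_set_guard:
  assumes "g \<in> X" "1 \<le> b (col g)"
  shows "reach X b p X (col g) (X - {g})"
proof -
  have *: "reach X b (\<not> col g) X (col g) (X - {g})"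
    using reach_single_step[of "{g}" X b "\<not> col g" X "X - {g}"] assms by auto
  show ?thesis
  proof (cases "p = col g")
    case True
    \<comment> \<open>An idle round moves the mouse off the colour of \<open>g\<close>, so that on
      its return a cat can wait at \<open>g\<close>.\<close>
    have "reach X b p X (\<not> p) X" by (rule reach_single_step[of "{}"]) auto
    then show ?thesis using * reach_trans True by blast
  next
    case False
    then show ?thesis using * by (cases p) auto
  qed
qed

text \<open>A guard at \<open>g\<close> is only needed when the mouse is at the colour of \<open>g\<close>.\<close>

lemma reach_inside_guarded:
  assumes "reach D b' p S q T"
    and g: "g \<in> X" and D: "closed_in adj (X - {g}) D" and R: "closed_in adj (X - {g}) R"
    and b: "\<And>c. b' c + of_bool (c = col g) \<le> b c"
  shows "reach X b p (S \<inter> D \<union> R) q (T \<inter> D \<union> R)"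
  using assms(1)
proof (induction rule: reach.induct)
  case (stop S p S')
  then show ?case by (auto intro: reach.stop)
next
  case (step C p S S1 q S')
  \<comment> \<open>The clearing of \<open>D\<close> gets an additional cat at \<open>g\<close> in
    the rounds where the mouse arrives at the colour of \<open>g\<close>.\<close>
  let ?C = "C \<union> (if col g = (\<not> p) then {g} else {})"
  show ?case
  proof (rule reach.step[of ?C])
    have "card ?C \<le> card C + of_bool ((\<not> p) = col g)"
      using step(1) by (auto simp: card_insert_if)
    also have "\<dots> \<le> b' (\<not> p) + of_bool ((\<not> p) = col g)"
      using step(3) by (intro add_right_mono)
    also have "\<dots> \<le> b (\<not> p)" by (rule b)
    finally show "card ?C \<le> b (\<not> p)" .
    show "?C \<subseteq> X" using step(2) g D by (auto simp: closed_in_def)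
    show "reach X b (\<not> p) (S1 \<inter> D \<union> R) q (S' \<inter> D \<union> R)" by fact
    fix x y assume xy: "x \<in> S \<inter> D \<union> R" "y \<in> X" "adj x y" "col y = (\<not> p)" "y \<notin> ?C"
    then have "y \<in> X - {g}" by (auto split: if_splits)
    then show "y \<in> S1 \<inter> D \<union> R"
      using xy closed_inD[OF D, of x y] closed_inD[OF R, of x y] step(4)[of x y] by auto
  qed (use step(1) in auto)
qed

text \<open>With \<open>g\<close> guarded the mouse cannot leave a closed set, so after each
  clearing it stays confined to the remaining pieces and \<open>R\<close>, which is kept for
  later.\<close>

lemma reach_clear_pieces:
  assumes "finite F" and g: "g \<in> X"
    and "\<And>D. D \<in> F \<Longrightarrow> closed_in adj (X - {g}) D \<and> clr D b'"
    and R: "closed_in adj (X - {g}) R"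
    and b: "\<And>c. b' c + of_bool (c = col g) \<le> b c"
  shows "\<exists>q. reach X b p (\<Union>F \<union> R) q R"
  using assms(1,3)
proof (induction F arbitrary: p)
  case empty
  show ?case by (auto intro: stop)
next
  case (insert D F)
  have 1: "closed_in adj (X - {g}) D" "clr D b'" using insert.prems by auto
  have "closed_in adj (X - {g}) E" if "E \<in> F" for E using insert.prems that by auto
  then have "closed_in adj (X - {g}) (\<Union>F \<union> R)"
    using R unfolding closed_in_def by blast
  moreover obtain q where "reach D b' p D q {}" using 1(2) by (auto simp: clr_def)
  ultimately have "reach X b p (D \<union> (\<Union>F \<union> R)) q (\<Union>F \<union> R)"
    using reach_inside_guarded[OF _ g 1(1) _ b, of p D q "{}" "\<Union>F \<union> R"] by simp
  moreover obtain r where "reach X b q (\<Union>F \<union> R) r R" using insert by blast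
  ultimately show ?case using reach_trans by (metis Union_insert Un_assoc)
qed

text \<open>The basic recursion: the guard at \<open>g\<close> is paid with one cat in the rounds of
  its colour, and the components it separates are cleared in turn with the budget
  \<open>b'\<close>.\<close>

lemma clr_via_guard:
  assumes X: "finite X" and g: "g \<in> X"
    and "\<And>D. component adj (X - {g}) D \<Longrightarrow> clr D b'"
    and b: "\<And>c. b' c + of_bool (c = col g) \<le> b c"
  shows "clr X b"
  unfolding clr_def
proof
  fix p
  let ?F = "{D. component adj (X - {g}) D}"
  have "1 \<le> b (col g)" using b[of "col g"] by simp
  then have "reach X b p X (col g) (X - {g})" using g by (rule reach_set_guard[rotated])
  moreover have "\<exists>q. reach X b (col g) (\<Union>?F \<union> {}) q {}"
    by (rule reach_clear_pieces[OF finite_components g _ _ b])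
      (use X assms(3) in \<open>auto simp: component_def closed_in_def\<close>)
  ultimately show "\<exists>q. reach X b p X q {}"
    using reach_trans unfolding Union_components Un_empty_right by blast
qed

text \<open>
  Since \<open>K\<close> has at most \<open>2 * t + 2\<close> vertices, at most one component of \<open>K - {c}\<close> is too large to be
  cleared while \<open>c\<close> is guarded; the guard then moves on to that component. The guard never
  needs to be at two vertices at once, because \<open>g\<close> and its neighbour \<open>c\<close> have different colours.
\<close>

lemma reach_sweep:
  assumes X: "finite X" "conn adj X"
    and b: "\<And>c. 1 \<le> b c"
    and small: "\<And>D c. conn adj D \<Longrightarrow> D \<subseteq> X \<Longrightarrow> card D \<le> t \<Longrightarrow> clr D (b(c := b c - 1))"
    and "g \<in> X" "component adj (X - {g}) K" "card K \<le> 2 * t + 2"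
  shows "\<exists>q. reach X b (col g) K q {}"
  using assms(5-7)
proof (induction "card K" arbitrary: g K rule: less_induct)
  case less
  note K = componentD[OF less.prems(2)]
  have finK: "finite K" using K(1) X(1) by (meson finite_Diff finite_subset)
  obtain c where c: "c \<in> K" "adj g c" using component_neighbour X(2) less.prems by blast
  have cX: "c \<in> X" using c K(1) by blast
  have colc: "col c = (\<not> col g)" using col_adj[OF c(2)] by blast
  have uniq: "z = c" if "z \<in> K" "adj g z" for z
    using unique_neighbour[OF K(3) _ that(1) c(1) that(2) c(2)] K(1) by blast
  \<comment> \<open>As \<open>c\<close> is the only neighbour of \<open>g\<close> in
    \<open>K\<close>, no vertex of \<open>K - {c}\<close> is adjacent to \<open>g\<close>; once
    \<open>c\<close> is guarded, the guard at \<open>g\<close> can be given up.\<close>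
  have lift: "closed_in adj (X - {c}) S" if S: "closed_in adj (K - {c}) S" for S
    unfolding closed_in_def
  proof (intro conjI ballI impI)
    show "S \<subseteq> X - {c}" using S K(1) by (auto simp: closed_in_def)
    fix x y assume xy: "x \<in> S" "y \<in> X - {c}" "adj x y"
    have x: "x \<in> K" "x \<noteq> c" using S xy(1) by (auto simp: closed_in_def)
    then have "y \<noteq> g" using uniq adj_sym xy(3) by blast
    then have "y \<in> K" using closed_inD[OF K(2) x(1)] xy by blast
    then show "y \<in> S" using closed_inD[OF S xy(1)] xy by blast
  qed
  \<comment> \<open>The guard moves from \<open>g\<close> to \<open>c\<close> in one round: the
    mouse arrives at the colour of \<open>c\<close>, so it cannot arrive at
    \<open>g\<close>.\<close>
  have first: "reach X b (col g) K (col c) (K - {c})"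
    unfolding colc
    by (rule reach_single_step[of "{c}"])
      (use cX b colc closed_inD[OF K(2)] col_adj in auto)
  let ?F = "{D. component adj (K - {c}) D}"
  have finF: "finite ?F" by (rule finite_components) (use finK in auto)
  have FK: "\<Union>?F = K - {c}" by (rule Union_components)
  have bud: "(b(col c := b (col c) - 1)) p + of_bool (p = col c) \<le> b p" for p
    using b[of "col c"] by auto
  have piece: "closed_in adj (X - {c}) D \<and> clr D (b(col c := b (col c) - 1))"
    if "component adj (K - {c}) D" "card D \<le> t" for D
    using that small[of D "col c"] lift componentD[OF that(1)] K(1) by blast
  show ?case
  proof (cases "\<exists>E\<in>?F. t < card E")
    case False
    have "\<exists>q. reach X b (col c) (\<Union>?F \<union> {}) q {}"
      by (rule reach_clear_pieces[OF finF cX _ _ bud])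
        (use piece False in \<open>auto simp del: fun_upd_apply simp: closed_in_def not_less\<close>)
    then show ?thesis using first reach_trans unfolding FK Un_empty_right by blast
  next
    case True
    then obtain E where E: "component adj (K - {c}) E" "t < card E" by blast
    have EK: "E \<subseteq> K - {c}" by (rule componentD(1)[OF E(1)])
    \<comment> \<open>Two components with more than \<open>t\<close> vertices, together with
      \<open>c\<close>, would give \<open>K\<close> at least \<open>2 * t + 3\<close>
      vertices.\<close>
    have other: "card D \<le> t" if D: "component adj (K - {c}) D" "D \<noteq> E" for D
    proof (rule ccontr)
      assume "\<not> card D \<le> t"
      moreover have "card (D \<union> E) = card D + card E"
        using components_disjoint[OF D(1) E(1) D(2)] componentD(1)[OF D(1)] EK finK
        by (intro card_Un_disjoint) (auto intro: finite_subset)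
      moreover have "card (D \<union> E) \<le> card (K - {c})"
        using componentD(1)[OF D(1)] EK finK by (intro card_mono) auto
      moreover have "card (K - {c}) < card K" using c finK by (intro card_Diff1_less)
      ultimately show False using E(2) less.prems(3) by linarith
    qed
    have "\<exists>q. reach X b (col c) (\<Union>(?F - {E}) \<union> E) q E"
      by (rule reach_clear_pieces[OF _ cX _ _ bud])
        (use finF piece other lift componentD(2)[OF E(1)] in \<open>auto simp del: fun_upd_apply\<close>)
    then obtain q where "reach X b (col c) (\<Union>(?F - {E}) \<union> E) q E" by blast
    moreover have "\<Union>(?F - {E}) \<union> E = K - {c}" using E(1) FK by blast
    ultimately have "reach X b (col g) K q E" using first reach_trans by metis
    moreover have E': "component adj (X - {c}) E"
      using lift componentD[OF E(1)] by (auto simp: component_def)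
    \<comment> \<open>Clearing the other pieces ends at an unknown colour \<open>q\<close>, whereas
      the induction hypothesis starts at \<open>col c\<close>.\<close>
    have "reach X b q E (col c) E"
      by (rule reach_keep_guard) (use cX b componentD[OF E'] in auto)
    moreover have "card E < card K" using EK c finK by (intro psubset_card_mono) auto
    then have "\<exists>r. reach X b (col c) E r {}"
      using less.hyps[OF _ cX E'] less.prems(3) by simp
    ultimately show ?thesis using reach_trans by meson
  qed
qed

section \<open>Induction on the number of cats\<close>

text \<open>The extra cat can guard a vertex of colour other than \<open>c\<close> whose branches
  have at most \<open>4 ^ k\<close> vertices. Failing that, all branches at some \<open>u\<close> of
  colour \<open>c\<close> have fewer than \<open>4 ^ k / 3\<close> vertices; one of the
  \<open>k\<close> cats guards \<open>u\<close>, and \<open>half\<close> clears the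
  branches.\<close>

lemma clr_step_half:
  assumes full: "\<And>X. conn adj X \<Longrightarrow> finite X \<Longrightarrow> card X \<le> 4 ^ k \<Longrightarrow> clr X (\<lambda>_. k)"
    and half: "\<And>X j c. k = Suc j \<Longrightarrow> conn adj X \<Longrightarrow> finite X \<Longrightarrow> 3 * card X \<le> 4 ^ k \<Longrightarrow>
      clr X (\<lambda>p. if p = c then j else k)"
    and X: "conn adj X" "finite X" "3 * card X \<le> 4 ^ Suc k"
  shows "clr X (\<lambda>p. if p = c then k else Suc k)"
proof (cases "card X \<le> 4 ^ k")
  case True
  then have "clr X (\<lambda>_. k)" using full X(1,2) by blast
  then show ?thesis by (rule clr_mono) auto
next
  case False
  define m :: nat where "m = 4 ^ k"
  have m: "1 \<le> m" "m < card X" "3 * card X \<le> 4 * m" using False X(3) by (auto simp: m_def)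
  have "2 \<le> card X" "card X \<le> 2 * m" using m by linarith+
  then obtain u K where u: "u \<in> X" and K: "component adj (X - {u}) K" "card K \<le> m"
    and other: "\<And>D. component adj (X - {u}) D \<Longrightarrow> D \<noteq> K \<Longrightarrow> m + card D < card X"
    using exists_maximal_component[OF X(1,2)] by metis
  have fin: "finite D" if "component adj (X - {w}) D" for D w
    using componentD(1)[OF that] X(2) by (meson finite_Diff finite_subset)
  have piece: "clr D (\<lambda>_. k)" if "component adj (X - {w}) D" "card D \<le> m" for D w
    using full componentD(3)[OF that(1)] fin[OF that(1)] that(2) by (auto simp: m_def)
  \<comment> \<open>Branches at \<open>u\<close> other than \<open>K\<close> have fewer than
    \<open>card X - m \<le> m / 3\<close> vertices. If \<open>u\<close> has colour \<open>c\<close>,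
    its neighbour in \<open>K\<close> is guarded instead when \<open>X - K\<close> is small; when
    \<open>X - K\<close> is large, \<open>K\<close> too has fewer than \<open>m / 3\<close>
    vertices.\<close>
  consider "col u \<noteq> c" | "col u = c" "card (X - K) \<le> m" | "col u = c" "m < card (X - K)"
    by linarith
  then show ?thesis
  proof cases
    case 1
    have "card D \<le> m" if "component adj (X - {u}) D" for D
      using other[OF that] K(2) m by (cases "D = K") auto
    then show ?thesis
      using piece 1 by (intro clr_via_guard[OF X(2) u, of "\<lambda>_. k"]) auto
  next
    case 2
    obtain d where d: "d \<in> K" "adj u d" using component_neighbour[OF X(1) u K(1)] by blast
    have dX: "d \<in> X" using d componentD(1)[OF K(1)] by blast
    have dc: "col d \<noteq> c" using col_adj[OF d(2)] 2 by auto
    note co = component_complement[OF X(1) u K(1) d]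
    have "card D \<le> m" if D: "component adj (X - {d}) D" for D
    proof (cases "D = X - K")
      case False
      then have "D \<subseteq> K" using components_disjoint[OF D co] componentD(1)[OF D] by blast
      then show ?thesis using card_mono[OF fin[OF K(1)]] K(2) order_trans by blast
    qed (use 2 in auto)
    then show ?thesis
      using piece dc by (intro clr_via_guard[OF X(2) dX, of "\<lambda>_. k"]) auto
  next
    case 3
    have "card (X - K) = card X - card K"
      using componentD(1)[OF K(1)] fin[OF K(1)] by (intro card_Diff_subset) auto
    then have *: "m + card D < card X" if "component adj (X - {u}) D" for D
      using other[OF that] 3 by (cases "D = K") auto
    have lt: "3 * card D < m" if "component adj (X - {u}) D" for D
      using *[OF that] m(3) by linarith
    \<comment> \<open>A nonempty branch with fewer than \<open>m / 3\<close> vertices excludes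
      \<open>k = 0\<close>, so a cat can be spared at colour \<open>c\<close>.\<close>
    have "card K \<noteq> 0" using componentD(4)[OF K(1)] fin[OF K(1)] by auto
    then have "m \<noteq> 1" using lt[OF K(1)] by auto
    then obtain j where j: "k = Suc j" unfolding m_def by (cases k) auto
    have "clr D (\<lambda>p. if p = c then j else k)" if "component adj (X - {u}) D" for D
      using half[OF j componentD(3)[OF that] fin[OF that]] lt[OF that] by (auto simp: m_def)
    then show ?thesis
      by (rule clr_via_guard[OF X(2) u]) (use 3 j in auto)
  qed
qed

text \<open>A guard at \<open>u\<close> leaves \<open>k + 1 / 2\<close> cats. They clear the
  branches other than \<open>K\<close>, each with at most a third of the vertices; then
  \<open>K\<close>, with at most two thirds, is swept.\<close>

lemma clr_step_full:
  assumes half: "\<And>X c. conn adj X \<Longrightarrow> finite X \<Longrightarrow> 3 * card X \<le> 4 ^ Suc k \<Longrightarrow>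
      clr X (\<lambda>p. if p = c then k else Suc k)"
    and X: "conn adj X" "finite X" "card X \<le> 4 ^ Suc k"
  shows "clr X (\<lambda>_. Suc k)"
proof (cases "card X \<le> 1")
  case True
  then show ?thesis using clr_card_le_1 X(2) by blast
next
  case False
  define t where "t = card X div 3"
  let ?b = "\<lambda>_ :: bool. Suc k"
  \<comment> \<open>After rounding, this threshold leaves at most \<open>t\<close> vertices in each
    other branch and at most \<open>2 * t + 1\<close> in \<open>K\<close>, within reach of the
    sweep.\<close>
  have "2 \<le> card X" "card X \<le> 2 * (2 * card X div 3)" using False by linarith+
  then obtain u K where u: "u \<in> X"
    and K: "component adj (X - {u}) K" "card K \<le> 2 * card X div 3"
    and other: "\<And>D. component adj (X - {u}) D \<Longrightarrow> D \<noteq> K \<Longrightarrow> 2 * card X div 3 + card D < card X"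
    using exists_maximal_component[OF X(1,2)] by metis
  have small: "clr D (?b(c := ?b c - 1))" if "conn adj D" "D \<subseteq> X" "card D \<le> t" for D c
  proof -
    have "3 * card D \<le> 4 ^ Suc k" using that(3) X(3) unfolding t_def by linarith
    then have "clr D (\<lambda>p. if p = c then k else Suc k)"
      using half that X(2) finite_subset by blast
    then show ?thesis by (rule clr_mono) auto
  qed
  have sweep: "\<exists>q. reach X ?b (col u) K q {}"
    by (rule reach_sweep[OF X(2,1) _ small u K(1)]) (use K(2) in \<open>auto simp: t_def\<close>)
  let ?F = "{D. component adj (X - {u}) D} - {K}"
  show ?thesis unfolding clr_def
  proof
    fix p
    have "reach X ?b p X (col u) (X - {u})" by (rule reach_set_guard) (use u in auto)
    moreover have "\<exists>q. reach X ?b (col u) (\<Union>?F \<union> K) q K"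
    proof (rule reach_clear_pieces[OF _ u, where b' = "?b(col u := ?b (col u) - 1)"])
      fix D assume "D \<in> ?F"
      then have D: "component adj (X - {u}) D" "D \<noteq> K" by auto
      have "card D \<le> t" using other[OF D] unfolding t_def by linarith
      then show "closed_in adj (X - {u}) D \<and> clr D (?b(col u := ?b (col u) - 1))"
        using small[of D "col u"] componentD[OF D(1)] by auto
    qed (use X(2) componentD[OF K(1)] in \<open>auto intro: finite_components\<close>)
    moreover have "\<Union>?F \<union> K = X - {u}" using Union_components[of "X - {u}"] K(1) by blast
    moreover have "reach X ?b q K (col u) K" for q
      by (rule reach_keep_guard) (use u componentD[OF K(1)] in auto)
    ultimately show "\<exists>q. reach X ?b p X q {}" using sweep reach_trans by metis
  qed
qed

text \<open>The first claim for \<open>Suc k\<close> follows from the second for \<open>k\<close>;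
  the second for \<open>Suc k\<close> follows from the first for \<open>Suc k\<close> and the second
  for \<open>k\<close>. At \<open>0\<close> both bounds allow at most one vertex.\<close>

lemma clr_full_and_half:
  "(\<forall>X. conn adj X \<longrightarrow> finite X \<longrightarrow> card X \<le> 4 ^ k \<longrightarrow> clr X (\<lambda>_. k)) \<and>
   (\<forall>X c. conn adj X \<longrightarrow> finite X \<longrightarrow> 3 * card X \<le> 4 ^ Suc k \<longrightarrow>
     clr X (\<lambda>p. if p = c then k else Suc k))"
proof (induction k)
  case 0
  have "clr X b" if "finite X" "3 * card X \<le> 4" for X b
    using that by (intro clr_card_le_1) auto
  then show ?case using clr_card_le_1 by auto
next
  case (Suc k)
  have full: "clr X (\<lambda>_. Suc k)"
    if "conn adj X" "finite X" "card X \<le> 4 ^ Suc k" for X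
    using clr_step_full[of k X] Suc that by blast
  have "clr X (\<lambda>p. if p = c then Suc k else Suc (Suc k))"
    if "conn adj X" "finite X" "3 * card X \<le> 4 ^ Suc (Suc k)" for X c
    using clr_step_half[of "Suc k" X c] full Suc that by (simp only: nat.inject) blast
  then show ?case using full by blast
qed

section \<open>From clearing a tree to a strategy\<close>

text \<open>\<open>C i\<close> is matched with \<open>v (Suc i)\<close> because \<open>reach\<close>
  lets the cats choose only after a move; \<open>v 0\<close> is not inspected.\<close>

lemma reach_strategy:
  assumes "reach X (\<lambda>_. k) p S q T"
  shows "\<exists>C t. (\<forall>i :: nat. C i \<subseteq> X \<and> finite (C i) \<and> card (C i) \<le> k) \<and>
    (\<forall>v. (\<forall>i. v i \<in> X \<and> adj (v i) (v (Suc i))) \<longrightarrow> (\<forall>i<t. v (Suc i) \<notin> C i) \<longrightarrow>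
      v 0 \<in> S \<longrightarrow> col (v 0) = p \<longrightarrow> v t \<in> T)"
  using assms
proof (induction rule: reach.induct)
  case (stop S p S')
  show ?case by (rule exI[of _ "\<lambda>_. {}"], rule exI[of _ 0]) (use stop in auto)
next
  case (step C0 p S S1 q S')
  then obtain C t where C: "\<forall>i :: nat. C i \<subseteq> X \<and> finite (C i) \<and> card (C i) \<le> k"
    and win: "\<And>v. (\<forall>i. v i \<in> X \<and> adj (v i) (v (Suc i))) \<Longrightarrow> (\<forall>i<t. v (Suc i) \<notin> C i) \<Longrightarrow>
      v 0 \<in> S1 \<Longrightarrow> col (v 0) = (\<not> p) \<Longrightarrow> v t \<in> S'"
    by blast
  let ?C = "case_nat C0 C"
  have "v (Suc t) \<in> S'"
    if v: "\<forall>i. v i \<in> X \<and> adj (v i) (v (Suc i))" "\<forall>i<Suc t. v (Suc i) \<notin> ?C i"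
      and v0: "v 0 \<in> S" "col (v 0) = p" for v
  proof -
    have i: "v i \<in> X" "adj (v i) (v (Suc i))" for i using v by auto
    have c1: "col (v (Suc 0)) = (\<not> p)" using col_adj[OF i(2)[of 0]] v0 by auto
    have "v (Suc 0) \<notin> C0" using v(2)[rule_format, of 0] by simp
    then have "v (Suc 0) \<in> S1" using step(4)[OF v0(1) i(1) i(1) i(2) c1] by simp
    moreover have "\<forall>i<t. v (Suc (Suc i)) \<notin> C i"
      using v(2)[rule_format, of "Suc i" for i] by simp
    ultimately show ?thesis using win[of "\<lambda>i. v (Suc i)"] i c1 by blast
  qed
  moreover have "\<forall>i. ?C i \<subseteq> X \<and> finite (?C i) \<and> card (?C i) \<le> k"
    using C step(1-3) by (auto split: nat.split)
  ultimately show ?case by blast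
qed

text \<open>The mice of the two parities are caught one after the other.\<close>

lemma clr_strategy:
  assumes "clr X (\<lambda>_. k)"
  shows "\<exists>C. (\<forall>i :: nat. C i \<subseteq> X \<and> finite (C i) \<and> card (C i) \<le> k) \<and>
    \<not> (\<exists>v. \<forall>i. v i \<in> X \<and> adj (v i) (v (Suc i)) \<and> v i \<notin> C i)"
proof -
  define walk where "walk v \<longleftrightarrow> (\<forall>i. v i \<in> X \<and> adj (v i) (v (Suc i)))" for v :: "nat \<Rightarrow> 'a"
  have "\<exists>C t. (\<forall>i :: nat. C i \<subseteq> X \<and> finite (C i) \<and> card (C i) \<le> k) \<and>
    (\<forall>v. walk v \<longrightarrow> (\<forall>i<t. v (Suc i) \<notin> C i) \<longrightarrow> col (v 0) \<noteq> p)" for p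
  proof -
    obtain q where "reach X (\<lambda>_. k) p X q {}" using assms unfolding clr_def by blast
    from reach_strategy[OF this] show ?thesis by (auto simp: walk_def)
  qed
  then obtain C t where C: "\<And>p i. C p i \<subseteq> X \<and> finite (C p i) \<and> card (C p i) \<le> k"
    and win: "\<And>p v. walk v \<Longrightarrow> (\<forall>i<t p. v (Suc i) \<notin> C p i) \<Longrightarrow> col (v 0) \<noteq> p"
    by metis
  define s where "s = t True"
  \<comment> \<open>Nothing is inspected at \<open>v 0\<close>. A mouse that survives the first plan
    started at colour \<open>False\<close>, so after \<open>s\<close> moves it has colour
    \<open>odd s\<close>, which selects the second plan.\<close>
  let ?C = "case_nat {} (\<lambda>i. if i < s then C True i else C (odd s) (i - s))"
  have False if v: "walk v" "\<And>i. v i \<notin> ?C i" for v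
  proof -
    have avoid: "v (Suc i) \<notin> (if i < s then C True i else C (odd s) (i - s))" for i
      using v(2)[of "Suc i"] by simp
    have "\<not> col (v 0)" using win[OF v(1), of True] avoid s_def by (metis (full_types))
    then have parity: "col (v i) = odd i" for i
    proof (induction i)
      case (Suc i)
      then show ?case using col_adj[of "v i" "v (Suc i)"] v(1) by (auto simp: walk_def)
    qed simp
    have "walk (\<lambda>i. v (s + i))" using v(1) by (auto simp: walk_def)
    moreover have "v (s + Suc i) \<notin> C (odd s) i" for i using avoid[of "s + i"] by simp
    ultimately show False using win[of "\<lambda>i. v (s + i)" "odd s"] parity[of s] by simp
  qed
  moreover have "\<forall>i. ?C i \<subseteq> X \<and> finite (?C i) \<and> card (?C i) \<le> k"
    using C by (auto split: nat.split)
  ultimately show ?thesis unfolding walk_def by (intro exI[of _ ?C] conjI notI) (blast, metis)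
qed

end

lemma (in forest) strategy_exists:
  assumes "conn adj X" "finite X" "card X \<le> 4 ^ k" and edges: "\<And>x y. adj x y \<Longrightarrow> x \<in> X \<and> y \<in> X"
  shows "\<exists>C. (\<forall>i :: nat. C i \<subseteq> X \<and> finite (C i) \<and> card (C i) \<le> k) \<and>
    \<not> (\<exists>v. \<forall>i. v i \<in> X \<and> adj (v i) (v (Suc i)) \<and> v i \<notin> C i)"
proof -
  obtain col :: "'a \<Rightarrow> bool" where "\<forall>x\<in>X. \<forall>y\<in>X. adj x y \<longrightarrow> col x \<noteq> col y"
    using proper_colouring_exists[OF assms(1,2)] by blast
  then have col: "adj x y \<Longrightarrow> col x \<noteq> col y" for x y using edges[of x y] by simp
  interpret bipartite_forest adj col by unfold_locales (rule col)
  show ?thesis using clr_strategy clr_full_and_half assms(1-3) by blast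
qed

section \<open>Trees as symmetric digraphs\<close>

text \<open>The vertices reachable from \<open>a\<close> inside \<open>D\<close> form a closed set,
  hence all of \<open>D\<close>. The resulting path serves to build a cycle.\<close>

lemma (in graph) conn_reachable:
  assumes D: "conn (dominates G) D" "D \<subseteq> verts G" and ab: "a \<in> D" "b \<in> D"
  shows "\<exists>p. apath a p b \<and> set (awalk_verts a p) \<subseteq> D"
proof -
  let ?H = "G \<restriction> D"
  interpret H: wf_digraph ?H by (rule wellformed_induce_subgraph)
  let ?S = "{x. a \<rightarrow>\<^sup>*\<^bsub>?H\<^esub> x}"
  have "?S \<subseteq> D" using H.reachable_in_verts by auto
  moreover have "y \<in> ?S" if "x \<in> ?S" "y \<in> D" "x \<rightarrow> y" for x y
  proof -
    have "x \<in> D" using that \<open>?S \<subseteq> D\<close> by blast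
    then have "x \<rightarrow>\<^bsub>?H\<^esub> y" using that by (auto simp: arcs_ends_conv)
    then show ?thesis using that(1) H.reachable_adj_trans by blast
  qed
  moreover have "a \<in> ?S" using ab by simp
  ultimately have "?S = D"
    using D(1) unfolding conn_def closed_in_def by blast
  then have "a \<rightarrow>\<^sup>*\<^bsub>?H\<^esub> b" using ab by blast
  then obtain p where p: "H.apath a p b" using H.reachable_apath by blast
  have sub: "subgraph ?H G" using D(2) by (intro subgraph_induce_subgraphI)
  have comp: "H.awalk_verts a p = awalk_verts a p"
    using compatible_awalk_verts[OF compatible_induce_subgraph] by metis
  have "set (H.awalk_verts a p) \<subseteq> D"
    using p unfolding H.apath_def H.awalk_conv by simp
  moreover have "apath a p b" using p sub comp
    by (auto simp: H.apath_def apath_def intro: subgraph_awalk_imp_awalk)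
  ultimately show ?thesis using comp by auto
qed

text \<open>If \<open>a \<noteq> b\<close>, a path from \<open>a\<close> to \<open>b\<close> inside
  \<open>D\<close> closed up through \<open>u\<close> is a cycle, of length at least 3 since the
  path has an arc.\<close>

lemma (in graph) forest_dominates:
  assumes "\<not> (\<exists>p. cycle p \<and> 3 \<le> length p)"
  shows "forest (dominates G)"
proof
  show "y \<rightarrow> x" if "x \<rightarrow> y" for x y using that by (rule graph_symmetric)
  show "\<not> x \<rightarrow> x" for x using no_loops by (auto simp: arcs_ends_conv)
  fix D u a b
  assume D: "conn (dominates G) D" "u \<notin> D" "a \<in> D" "b \<in> D" "u \<rightarrow> a" "u \<rightarrow> b"
  show "a = b"
  proof (rule ccontr)
    assume ne: "a \<noteq> b"
    \<comment> \<open>Arcs join vertices of \<open>G\<close>, so \<open>D \<inter> verts G\<close>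
      is closed in \<open>D\<close>; as it contains \<open>a\<close>, it is all of
      \<open>D\<close>.\<close>
    have "closed_in (dominates G) D (D \<inter> verts G)"
      by (auto simp: closed_in_def adj_in_verts)
    moreover have "a \<in> D \<inter> verts G" using D(3,5) by (auto simp: adj_in_verts)
    ultimately have "D \<subseteq> verts G" using D(1) unfolding conn_def by blast
    then obtain p where p: "apath a p b" "set (awalk_verts a p) \<subseteq> D"
      using conn_reachable D by blast
    obtain e where e: "e \<in> arcs G" "tail G e = u" "head G e = a" using D(5) by blast
    obtain f where f: "f \<in> arcs G" "tail G f = b" "head G f = u"
      using graph_symmetric[OF D(6)] by blast
    have w: "awalk a p b" "distinct (awalk_verts a p)" using p by (auto simp: apath_def)
    have "awalk u (e # p @ [f]) u" using e f w(1) by (auto simp: awalk_simps)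
    moreover have "awalk_verts a (p @ [f]) = awalk_verts a p @ [u]"
      using awalk_verts_append[of a p "[f]" u] w(1) f by (auto simp: awalk_simps)
    then have "distinct (tl (awalk_verts u (e # p @ [f])))"
      using w(2) p(2) D(2) e by auto
    moreover have "p \<noteq> []" using w(1) ne by (auto simp: awalk_simps)
    then have "3 \<le> length (e # p @ [f])" by (cases p) auto
    ultimately show False using assms unfolding cycle_def by blast
  qed
qed

lemma (in graph) conn_verts:
  assumes "Digraph_Component.connected G"
  shows "conn (dominates G) (verts G)"
proof -
  have sc: "strongly_connected G"
    using sym_arcs assms by (rule symmetric_connected_imp_strongly_connected)
  have "S = verts G" if S: "closed_in (dominates G) (verts G) S" "S \<noteq> {}" for S
  proof -
    obtain a where a: "a \<in> S" using S by blast
    have "b \<in> S" if "a \<rightarrow>\<^sup>* b" for b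
      using that
    proof (induction rule: reachable_induct)
      case base
      show ?case by fact
    next
      case (step x y)
      then show ?case using closed_inD[OF S(1)] adj_in_verts by blast
    qed
    then show ?thesis using sc a S by (auto simp: strongly_connected_def closed_in_def)
  qed
  then show ?thesis using sc by (auto simp: conn_def strongly_connected_def)
qed

theorem theorem1p4:
  fixes T :: "('a, 'b) pre_digraph" and n :: nat
  assumes "undirected_tree T" and "card (verts T) = n"
  shows "int (cat_number T) \<le> \<lceil>1 / 2 * log 2 (real n)\<rceil>"
proof -
  interpret graph T using assms(1) by (simp add: undirected_tree_def)
  interpret F: forest "dominates T"
    using forest_dominates assms(1) by (simp add: undirected_tree_def)
  \<comment> \<open>The ceiling is nonnegative because \<open>1 \<le> n\<close>, so
    \<open>nat\<close> does not truncate.\<close>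
  define k where "k = nat \<lceil>1 / 2 * log 2 (real n)\<rceil>"
  have conn: "conn (dominates T) (verts T)"
    using assms(1) by (intro conn_verts) (simp add: undirected_tree_def)
  then have "verts T \<noteq> {}" by (simp add: conn_def)
  then have n: "1 \<le> n" using assms(2) by (metis One_nat_def Suc_leI card_gt_0_iff finite_verts)
  then have "0 \<le> 1 / 2 * log 2 (real n)" by simp
  then have "0 \<le> \<lceil>1 / 2 * log 2 (real n)\<rceil>" using ceiling_mono by (metis ceiling_zero)
  then have k: "int k = \<lceil>1 / 2 * log 2 (real n)\<rceil>" unfolding k_def by (rule nat_0_le)
  have "log 2 (real n) \<le> 2 * real k" using k by linarith
  then have "real n \<le> 2 powr (2 * real k)" using n by (simp add: log_le_iff)
  also have "\<dots> = 4 ^ k" by (simp add: powr_mult powr_realpow flip: powr_powr)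
  finally have "real (card (verts T)) \<le> real (4 ^ k)" using assms(2) by simp
  then have "card (verts T) \<le> 4 ^ k" by (simp only: of_nat_le_iff)
  then obtain C where
    C: "\<forall>i :: nat. C i \<subseteq> verts T \<and> finite (C i) \<and> card (C i) \<le> k"
    and no_walk: "\<not> (\<exists>v. \<forall>i. v i \<in> verts T \<and> v i \<rightarrow>\<^bsub>T\<^esub> v (Suc i) \<and> v i \<notin> C i)"
    using F.strategy_exists[OF conn finite_verts, of k] adj_in_verts by auto
  have "cat_win T k"
    unfolding cat_win_def cat_strategy_def
  proof (intro exI[of _ C] conjI)
    show "\<not> (\<exists>v. evades T C v)" using no_walk unfolding evades_def by metis
  qed (rule C)
  then have "cat_number T \<le> k" unfolding cat_number_def by (rule Least_le)
  then show ?thesis using k by linarith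
qed

end
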